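(* Let $\alpha\beta\neq0$ and let $S(n,k)=S(n,k,\alpha,\beta,r)$ be the generalized Stirling numbers. The $A$-sequence $(a_n)_{n\in\mathbb{N}_0}$ of the Riordan array $[d_{n,k}=k!\,S(n,k)/n!]_{0\le k\le n}$ satisfies $$a_0=1,\qquad a_n=-\frac{1}{\alpha}\sum_{k=1}^n a_{n-k}\,\frac{\langle\alpha\rangle_{k+1,-\beta}}{(k+1)!}\quad\text{for all } n\ge1.$$
   Context: The parameters $\alpha,\beta,r$ are real or complex. For a number $\beta$ and $n\in\mathbb{N}_0$, $\langle z\rangle_{n,-\beta}:=z(z-\beta)\cdots(z-(n-1)\beta)$, with $\langle z\rangle_{0,-\beta}=1$. The generalized Stirling numbers $S(n,k,\alpha,\beta,r)$, $0\le k\le n$, are the unique coefficients in the polynomial identity $\langle z\rangle_{n,-\alpha}=\sum_{k=0}^n S(n,k,\alpha,\beta,r)\langle z-r\rangle_{k,-\beta}$, and $S(n,k,\alpha,\beta,r)=0$ for $k>n$. For $\alpha\beta\ne0$ they have the generating function $$\frac{1}{k!}(1+\alpha z)^{r/\alpha}\left(\frac{(1+\alpha z)^{\beta/\alpha}-1}{\beta}\right)^k=\sum_{n\ge0}S(n,k)\frac{z^n}{n!},$$ so $[k!\,S(n,k)/n!]$ is the (classical) Riordan array $(d(z),h(z))$ with entries $d_{n,k}=[z^n]\,d(z)h(z)^k$, where $d(z)=(1+\alpha z)^{r/\alpha}$ and $h(z)=((1+\alpha z)^{\beta/\alpha}-1)/\beta$. The $A$-sequence of a Riordan array $(d_{n,k})=(d(z),h(z))$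 (with $d$ of order $0$ and $h$ of order $1$) is the unique sequence $(a_j)_{j\ge0}$ such that $d_{n+1,k+1}=\sum_{j\ge0}a_j\,d_{n,k+j}$ for all $n,k\ge0$; equivalently, its generating function $A(t)=\sum_{j\ge0}a_jt^j$ is determined by $t\,A(h(t))=h(t)$. *)

theory Defs
  imports "HOL-Computational_Algebra.Computational_Algebra"
begin

text \<open>
  \<open>gen_falling z n \<beta>\<close> is \<open>\<langle>z\<rangle>\<^bsub>n,-\<beta>\<^esub> = z (z - \<beta>) \<dots> (z - (n - 1) \<beta>)\<close>; note the sign of \<open>\<beta>\<close>.
  The ring is arbitrary so that \<open>z\<close> may be a number or a polynomial indeterminate.
\<close>
definition gen_falling :: "'a::comm_ring_1 \<Rightarrow> nat \<Rightarrow> 'a \<Rightarrow> 'a" where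
  "gen_falling z n \<beta> = (\<Prod>i<n. z - of_nat i * \<beta>)"

text \<open>
  The coefficients of \<open>\<langle>z\<rangle>\<^bsub>n,-\<alpha>\<^esub>\<close> in the basis \<open>\<langle>z - r\<rangle>\<^bsub>k,-\<beta>\<^esub>\<close>: an identity of polynomials
  in the indeterminate \<open>z = [:0, 1:]\<close>.
\<close>
definition is_gen_stirling_row ::
  "'a::field_char_0 \<Rightarrow> 'a \<Rightarrow> 'a \<Rightarrow> nat \<Rightarrow> (nat \<Rightarrow> 'a) \<Rightarrow> bool" where
  "is_gen_stirling_row \<alpha> \<beta> r n c \<longleftrightarrow>
     gen_falling [:0, 1:] n [:\<alpha>:] =
       (\<Sum>k\<le>n. smult (c k) (gen_falling ([:0, 1:] - [:r:]) k [:\<beta>:])) \<and>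
     (\<forall>k>n. c k = 0)"

definition gen_stirling :: "'a::field_char_0 \<Rightarrow> 'a \<Rightarrow> 'a \<Rightarrow> nat \<Rightarrow> nat \<Rightarrow> 'a" where
  "gen_stirling \<alpha> \<beta> r n = (THE c. is_gen_stirling_row \<alpha> \<beta> r n c)"

definition riordan_array :: "'a::field_char_0 fps \<Rightarrow> 'a fps \<Rightarrow> nat \<Rightarrow> nat \<Rightarrow> 'a" where
  "riordan_array d h n k = fps_nth (d * h ^ k) n"

definition is_riordan_array :: "(nat \<Rightarrow> nat \<Rightarrow> 'a::field_char_0) \<Rightarrow> bool" where
  "is_riordan_array D \<longleftrightarrow>
     (\<exists>d h. fps_nth d 0 \<noteq> 0 \<and> fps_nth h 0 = 0 \<and> fps_nth h 1 \<noteq> 0 \<and> D = riordan_array d h)"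

text \<open>
  A Riordan array is lower triangular, so in \<open>\<Sum>j\<ge>0. a j * D n (k + j)\<close> all terms with
  \<open>j > n\<close> vanish and the sum is finite.
\<close>
definition is_A_sequence :: "(nat \<Rightarrow> nat \<Rightarrow> 'a::field_char_0) \<Rightarrow> (nat \<Rightarrow> 'a) \<Rightarrow> bool" where
  "is_A_sequence D a \<longleftrightarrow> is_riordan_array D \<and>
     (\<forall>n k. D (Suc n) (Suc k) = (\<Sum>j\<le>n. a j * D n (k + j)))"

definition A_sequence :: "(nat \<Rightarrow> nat \<Rightarrow> 'a::field_char_0) \<Rightarrow> nat \<Rightarrow> 'a" where
  "A_sequence D = (THE a. is_A_sequence D a)"

text \<open>Both descriptions determine a unique sequence.\<close>

lemma gen_falling_0: "gen_falling z 0 \<beta> = 1"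
  by (simp add: gen_falling_def)

lemma gen_falling_Suc: "gen_falling z (Suc n) \<beta> = gen_falling z n \<beta> * (z - of_nat n * \<beta>)"
  by (simp add: gen_falling_def)

lemma gen_falling_poly_degree:
  fixes r \<beta> :: "'a::field_char_0"
  shows "degree (gen_falling ([:0, 1:] - [:r:]) n [:\<beta>:]) = n \<and>
         lead_coeff (gen_falling ([:0, 1:] - [:r:]) n [:\<beta>:]) = 1"
proof (induction n)
  case 0
  then show ?case by (simp add: gen_falling_0)
next
  case (Suc n)
  have e: "[:0, 1:] - [:r:] - of_nat n * [:\<beta>:] = [:- r - of_nat n * \<beta>, 1:]"
    by (simp add: of_nat_poly)
  from Suc.IH have "gen_falling ([:0, 1:] - [:r:]) n [:\<beta>:] \<noteq> 0"
    by (metis leading_coeff_0_iff zero_neq_one)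
  then have "degree (gen_falling ([:0, 1:] - [:r:]) n [:\<beta>:] * [:- r - of_nat n * \<beta>, 1:]) = Suc n"
    using Suc.IH by (subst degree_mult_eq) auto
  moreover have
    "lead_coeff (gen_falling ([:0, 1:] - [:r:]) n [:\<beta>:] * [:- r - of_nat n * \<beta>, 1:]) = 1"
    using Suc.IH by (subst lead_coeff_mult) auto
  ultimately show ?case
    unfolding gen_falling_Suc e by blast
qed

lemma triangular_coeffs_zero:
  fixes p :: "nat \<Rightarrow> 'a::field_char_0 poly"
  assumes "\<And>k. degree (p k) = k" "\<And>k. lead_coeff (p k) = 1"
  shows "(\<Sum>k<n. smult (c k) (p k)) = 0 \<Longrightarrow> k < n \<Longrightarrow> c k = 0"
proof (induction n arbitrary: k)
  case 0
  then show ?case by simp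
next
  case (Suc n)
  have z: "coeff (p i) n = 0" if "i < n" for i
    using assms(1)[of i] that by (simp add: coeff_eq_0)
  have "0 = coeff (\<Sum>k<Suc n. smult (c k) (p k)) n"
    using Suc.prems(1) by simp
  also have "\<dots> = c n * coeff (p n) n"
    by (simp add: coeff_sum z)
  finally have "c n = 0"
    using assms(1,2)[of n] by simp
  with Suc show ?case
    by (auto simp: less_Suc_eq)
qed

lemma ex1_gen_stirling_row: "\<exists>!c. is_gen_stirling_row \<alpha> \<beta> r n (c :: nat \<Rightarrow> 'a::field_char_0)"
proof (rule ex_ex1I)
  let ?p = "\<lambda>k. gen_falling ([:0, 1:] - [:r:]) k [:\<beta>:]"
  show "\<exists>c. is_gen_stirling_row \<alpha> \<beta> r n c"
  proof (induction n)
    case 0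
    then show ?case
      by (intro exI[of _ "\<lambda>k. if k = 0 then 1 else 0"])
        (simp add: is_gen_stirling_row_def gen_falling_0)
  next
    case (Suc n)
    then obtain c where c: "gen_falling [:0, 1:] n [:\<alpha>:] = (\<Sum>k\<le>n. smult (c k) (?p k))"
      and c0: "\<forall>k>n. c k = 0"
      by (auto simp: is_gen_stirling_row_def)
    define u where "u k = of_nat k * \<beta> + r - of_nat n * \<alpha>" for k
    define c' where
      "c' k = (case k of 0 \<Rightarrow> 0 | Suc j \<Rightarrow> c j) + u k * c k" for k
    have step: "?p k * ([:0, 1:] - of_nat n * [:\<alpha>:]) = ?p (Suc k) + smult (u k) (?p k)" for k
    proof -
      have "[:0, 1:] - of_nat n * [:\<alpha>:] = ([:0, 1:] - [:r:] - of_nat k * [:\<beta>:]) + [:u k:]"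
        by (simp add: u_def of_nat_poly)
      then show ?thesis
        unfolding gen_falling_Suc by (simp only: distrib_left) simp
    qed
    have "gen_falling [:0, 1:] (Suc n) [:\<alpha>:]
        = (\<Sum>k\<le>n. smult (c k) (?p (Suc k))) + (\<Sum>k\<le>n. smult (u k * c k) (?p k))"
      unfolding gen_falling_Suc c sum_distrib_right mult_smult_left
      by (subst step[unfolded gen_falling_Suc])
        (simp add: smult_add_right sum.distrib mult.commute gen_falling_Suc)
    also have "(\<Sum>k\<le>n. smult (c k) (?p (Suc k)))
        = (\<Sum>k\<le>Suc n. smult (case k of 0 \<Rightarrow> 0 | Suc j \<Rightarrow> c j) (?p k))"
      by (subst sum.atMost_Suc_shift) simp
    also have "(\<Sum>k\<le>n. smult (u k * c k) (?p k)) = (\<Sum>k\<le>Suc n. smult (u k * c k) (?p k))"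
      using c0 by simp
    finally have "gen_falling [:0, 1:] (Suc n) [:\<alpha>:] = (\<Sum>k\<le>Suc n. smult (c' k) (?p k))"
      by (simp only: c'_def smult_add_left sum.distrib)
    moreover have "\<forall>k>Suc n. c' k = 0"
      using c0 by (auto simp: c'_def split: nat.splits)
    ultimately show ?case
      unfolding is_gen_stirling_row_def by blast
  qed
  fix c c'
  assume A: "is_gen_stirling_row \<alpha> \<beta> r n c" "is_gen_stirling_row \<alpha> \<beta> r n c'"
  have "(\<Sum>k<Suc n. smult (c k - c' k) (?p k)) = 0"
    using A by (simp only: is_gen_stirling_row_def smult_diff_left sum_subtractf lessThan_Suc_atMost)
      simp
  then have "c k - c' k = 0" if "k < Suc n" for k
    using triangular_coeffs_zero[of ?p "\<lambda>k. c k - c' k" "Suc n" k] that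
      gen_falling_poly_degree by blast
  moreover have "c k = c' k" if "k > n" for k
    using A that by (simp add: is_gen_stirling_row_def)
  ultimately show "c = c'"
    by (metis eq_iff_diff_eq_0 ext not_less_eq)
qed

lemma riordan_array_above_diagonal:
  assumes "fps_nth h 0 = 0" "n < k"
  shows "riordan_array d h n k = 0"
proof -
  have "fps_nth (h ^ k) i = 0" if "i \<le> n" for i
    using assms that startsby_zero_power_prefix[of h k] by auto
  then show ?thesis
    by (auto simp: riordan_array_def fps_mult_nth intro!: sum.neutral)
qed

lemma riordan_array_diagonal:
  assumes "fps_nth h 0 = 0"
  shows "riordan_array d h n n = fps_nth d 0 * fps_nth h 1 ^ n"
proof -
  have z: "fps_nth (h ^ n) i = 0" if "i < n" for i
    using assms that startsby_zero_power_prefix[of h n] by auto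
  have "riordan_array d h n n = (\<Sum>i\<in>{0..n}. if i = 0 then fps_nth d 0 * fps_nth (h ^ n) n else 0)"
    unfolding riordan_array_def fps_mult_nth by (intro sum.cong) (auto simp: z)
  then show ?thesis
    using startsby_zero_power_nth_same[OF assms, of n] by simp
qed

lemma ex1_A_sequence:
  fixes D :: "nat \<Rightarrow> nat \<Rightarrow> 'a::field_char_0"
  assumes "is_riordan_array D"
  shows "\<exists>!a. is_A_sequence D a"
proof -
  from assms obtain d h where d: "fps_nth d 0 \<noteq> 0" and h0: "fps_nth h 0 = 0"
    and h1: "fps_nth h 1 \<noteq> 0" and D: "D = riordan_array d h"
    by (auto simp: is_riordan_array_def)
  show ?thesis
  proof (rule ex_ex1I)
    define q where "q = fps_shift 1 h"
    have hq: "h = fps_X * q"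
      using h0 by (intro fps_ext) (auto simp: q_def)
    define A where "A = fps_compose q (fps_inv h)"
    have Ah: "fps_compose A h = q"
    proof -
      have "fps_compose A h = fps_compose q (fps_compose (fps_inv h) h)"
        unfolding A_def by (rule fps_compose_assoc[symmetric]) (simp_all add: h0 fps_inv_def)
      then show ?thesis
        using fps_inv[OF h0 h1] by simp
    qed
    have "D (Suc n) (Suc k) = (\<Sum>j\<le>n. fps_nth A j * D n (k + j))" for n k
    proof -
      have "d * h ^ Suc k = d * (fps_X * q) * h ^ k"
        by (simp add: hq[symmetric] mult.assoc)
      also have "\<dots> = fps_X * ((d * h ^ k) * q)"
        by (simp only: mult_ac)
      finally have "D (Suc n) (Suc k) = fps_nth (fps_X * ((d * h ^ k) * q)) (Suc n)"
        by (simp only: D riordan_array_def)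
      then have "D (Suc n) (Suc k) = fps_nth ((d * h ^ k) * fps_compose A h) n"
        by (simp add: Ah)
      also have "\<dots> = (\<Sum>i=0..n. fps_nth (d * h ^ k) i *
                        (\<Sum>j=0..n. fps_nth A j * fps_nth (h ^ j) (n - i)))"
        unfolding fps_mult_nth[of "d * h ^ k"]
      proof (intro sum.cong refl arg_cong2[where f = "(*)"])
        fix i assume "i \<in> {0..n}"
        have "(\<Sum>j=0..n. fps_nth A j * fps_nth (h ^ j) (n - i))
            = (\<Sum>j=0..n - i. fps_nth A j * fps_nth (h ^ j) (n - i))"
          using startsby_zero_power_prefix[OF h0]
          by (intro sum.mono_neutral_right) (auto simp: not_le)
        then show "fps_nth (fps_compose A h) (n - i)
            = (\<Sum>j=0..n. fps_nth A j * fps_nth (h ^ j) (n - i))"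
          by (simp add: fps_compose_nth)
      qed
      also have "\<dots> = (\<Sum>j=0..n. fps_nth A j * fps_nth ((d * h ^ k) * h ^ j) n)"
        unfolding fps_mult_nth[of "d * h ^ k"] sum_distrib_left
        by (subst sum.swap) (simp add: mult_ac)
      finally show ?thesis
        by (simp add: D riordan_array_def power_add mult.assoc atMost_atLeast0)
    qed
    then show "\<exists>a. is_A_sequence D a"
      using assms unfolding is_A_sequence_def by blast
  next
    fix a b
    assume ab: "is_A_sequence D a" "is_A_sequence D b"
    have "a n = b n" for n
    proof (induction n rule: less_induct)
      case (less n)
      have nz: "D n n \<noteq> 0"
        using d h1 by (simp add: D riordan_array_diagonal[OF h0])
      have "D (Suc n) (Suc 0) = (\<Sum>j\<le>n. a j * D n (0 + j))"
        and "D (Suc n) (Suc 0) = (\<Sum>j\<le>n. b j * D n (0 + j))"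
        using ab unfolding is_A_sequence_def by blast+
      then have "(\<Sum>j<n. a j * D n j) + a n * D n n = (\<Sum>j<n. b j * D n j) + b n * D n n"
        by (simp add: lessThan_Suc_atMost[symmetric])
      moreover have "(\<Sum>j<n. a j * D n j) = (\<Sum>j<n. b j * D n j)"
        by (intro sum.cong) (auto simp: less)
      ultimately show ?case
        using nz by simp
    qed
    then show "a = b" by blast
  qed
qed

end

theory Submission imports Defs begin

text \<open>
  Write \<open>(1 + \<gamma> z)\<^bsup>c/\<gamma>\<^esup> = \<Sum>\<^sub>n \<langle>c\<rangle>\<^bsub>n,-\<gamma>\<^esub> z\<^sup>n / n!\<close>, let \<open>d = (1 + \<alpha> z)\<^bsup>r/\<alpha>\<^esup>\<close> and let
  \<open>h = ((1 + \<alpha> z)\<^bsup>\<beta>/\<alpha>\<^esup> - 1) / \<beta>\<close>, so that \<open>1 + \<beta> h = (1 + \<alpha> z)\<^bsup>\<beta>/\<alpha>\<^esup>\<close>. Everything rests on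
  the change of base \<open>d \<cdot> (1 + \<beta> h)\<^bsup>(x - r)/\<beta>\<^esup> = (1 + \<alpha> z)\<^bsup>x/\<alpha>\<^esup>\<close>. For \<open>x = r + m \<beta>\<close> with
  \<open>m\<close> a natural number it only involves \<open>m\<close>-th powers and the law of exponents. The coefficient
  of \<open>z\<^sup>n\<close> on each side is a polynomial in \<open>x\<close>, and two polynomials that agree at infinitely
  many points are equal, so it holds for every \<open>x\<close>.

  Read coefficient by coefficient, this polynomial identity is the definition of the generalized
  Stirling numbers; hence \<open>k! S(n,k) / n!\<close> is the Riordan array of \<open>d\<close> and \<open>h\<close>
  (\<open>is_gen_stirling_row_riordan_array\<close>). Taken at \<open>r = 0\<close> and \<open>x = \<alpha>\<close>, it says that
  \<open>g(w) = ((1 + \<beta> w)\<^bsup>\<alpha>/\<beta>\<^esup> - 1) / \<alpha>\<close> is the compositional inverse of \<open>h\<close>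
  (\<open>gen_stirling_h_compose\<close>).

  The generating function \<open>A\<close> of the A-sequence is characterised by \<open>z A(h(z)) = h(z)\<close>
  (\<open>A_sequence_riordan_array\<close>), so \<open>A(w) = w / g(w)\<close>. Comparing coefficients in
  \<open>A(w) \<cdot> (g(w) / w) = 1\<close>, where \<open>g(w) / w\<close> has the coefficients
  \<open>\<langle>\<alpha>\<rangle>\<^bsub>k+1,-\<beta>\<^esub> / (\<alpha> (k+1)!)\<close>, gives the recurrence.
\<close>

section \<open>Binomial series\<close>

text \<open>The series \<open>(1 + \<gamma> z)\<^bsup>c/\<gamma>\<^esup>\<close>.\<close>
definition binomial_series :: "'a::field_char_0 \<Rightarrow> 'a \<Rightarrow> 'a fps" where
  "binomial_series \<gamma> c = Abs_fps (\<lambda>n. gen_falling c n \<gamma> / fact n)"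

lemma binomial_series_nth [simp]:
  "fps_nth (binomial_series \<gamma> c) n = gen_falling c n \<gamma> / fact n"
  by (simp add: binomial_series_def)

lemma gen_falling_1 [simp]: "gen_falling z (Suc 0) \<beta> = z"
  by (simp add: gen_falling_def)

text \<open>This transports the law of exponents from the library's \<open>fps_binomial\<close>, the case \<open>\<gamma> = 1\<close>.\<close>
lemma binomial_series_eq_fps_binomial:
  assumes "\<gamma> \<noteq> 0"
  shows "binomial_series \<gamma> c = fps_compose (fps_binomial (c / \<gamma>)) (fps_const \<gamma> * fps_X)"
proof (rule fps_ext)
  fix n
  have "gen_falling c n \<gamma> = (\<Prod>i<n. \<gamma> * (c / \<gamma> - of_nat i))"
    unfolding gen_falling_def using assms by (intro prod.cong) (auto simp: field_simps)
  also have "\<dots> = \<gamma> ^ n * (\<Prod>i<n. c / \<gamma> - of_nat i)"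
    by (simp add: prod.distrib)
  finally show "fps_nth (binomial_series \<gamma> c) n =
      fps_nth (fps_compose (fps_binomial (c / \<gamma>)) (fps_const \<gamma> * fps_X)) n"
    by (simp add: fps_compose_linear gbinomial_prod_rev atLeast0LessThan)
qed

lemma binomial_series_add:
  assumes "\<gamma> \<noteq> 0"
  shows "binomial_series \<gamma> (b + c) = binomial_series \<gamma> b * binomial_series \<gamma> c"
  by (simp add: binomial_series_eq_fps_binomial[OF assms] add_divide_distrib
      fps_binomial_add_mult fps_compose_mult_distrib)

lemma binomial_series_0: "binomial_series \<gamma> 0 = 1"
proof (rule fps_ext)
  fix n show "fps_nth (binomial_series \<gamma> 0) n = fps_nth 1 n"
    by (cases n) (auto simp: gen_falling_def)
qed

lemma binomial_series_of_nat_mult: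
  assumes "\<gamma> \<noteq> 0"
  shows "binomial_series \<gamma> (of_nat m * c) = binomial_series \<gamma> c ^ m"
  by (induction m) (simp_all add: binomial_series_0 binomial_series_add[OF assms] distrib_right)

lemma binomial_series_self: "binomial_series \<gamma> \<gamma> = 1 + fps_const \<gamma> * fps_X"
proof (rule fps_ext)
  fix n
  have "gen_falling \<gamma> (Suc (Suc k)) \<gamma> = 0" for k
    unfolding gen_falling_def by (rule prod_zero) (auto intro!: bexI[of _ 1])
  then show "fps_nth (binomial_series \<gamma> \<gamma>) n = fps_nth (1 + fps_const \<gamma> * fps_X) n"
    by (cases n rule: nat.exhaust; cases "n - 1") (auto simp: gen_falling_0)
qed

section \<open>Riordan arrays and their A-sequences\<close>

text \<open>
  The fundamental theorem of Riordan arrays: applying the array to the coefficients of \<open>f\<close> yields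
  those of \<open>d \<cdot> f(h)\<close>.
\<close>
lemma riordan_array_apply:
  assumes h0: "fps_nth h 0 = 0"
  shows "fps_nth (d * fps_compose f h) n = (\<Sum>k\<le>n. fps_nth f k * riordan_array d h n k)"
proof -
  have "fps_nth (fps_compose f h) i = (\<Sum>k\<le>n. fps_nth f k * fps_nth (h ^ k) i)" if "i \<le> n" for i
    unfolding fps_compose_nth
    using that startsby_zero_power_prefix[OF h0] by (intro sum.mono_neutral_left) auto
  then have "fps_nth (d * fps_compose f h) n =
      (\<Sum>i=0..n. fps_nth d i * (\<Sum>k\<le>n. fps_nth f k * fps_nth (h ^ k) (n - i)))"
    by (simp add: fps_mult_nth)
  also have "\<dots> = (\<Sum>k\<le>n. fps_nth f k * riordan_array d h n k)"
    unfolding riordan_array_def fps_mult_nth sum_distrib_left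
    by (subst sum.swap) (simp add: mult_ac)
  finally show ?thesis .
qed

text \<open>
  Replacing one factor \<open>h\<close> of \<open>d h\<^bsup>k+1\<^esup>\<close> by \<open>z A(h)\<close> shifts the row index and leaves
  \<open>d h\<^sup>k \<cdot> A(h)\<close>, to which the fundamental theorem applies.
\<close>
lemma A_sequence_riordan_array:
  assumes d: "fps_nth d 0 \<noteq> 0" and h0: "fps_nth h 0 = 0" and h1: "fps_nth h 1 \<noteq> 0"
    and A: "fps_X * fps_compose A h = h"
  shows "A_sequence (riordan_array d h) = fps_nth A"
proof -
  have "riordan_array d h (Suc n) (Suc k) = (\<Sum>j\<le>n. fps_nth A j * riordan_array d h n (k + j))"
    for n k
  proof -
    have "d * h ^ Suc k = d * h ^ k * (fps_X * fps_compose A h)"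
      by (simp add: A mult_ac)
    also have "\<dots> = fps_X * (d * h ^ k * fps_compose A h)"
      by (simp only: mult_ac)
    finally have "riordan_array d h (Suc n) (Suc k) = fps_nth (d * h ^ k * fps_compose A h) n"
      by (simp only: riordan_array_def fps_X_mult_nth) simp
    also have "\<dots> = (\<Sum>j\<le>n. fps_nth A j * riordan_array (d * h ^ k) h n j)"
      by (rule riordan_array_apply[OF h0])
    finally show ?thesis
      by (simp add: riordan_array_def power_add mult.assoc)
  qed
  moreover have R: "is_riordan_array (riordan_array d h)"
    using d h0 h1 unfolding is_riordan_array_def by blast
  ultimately have "is_A_sequence (riordan_array d h) (fps_nth A)"
    unfolding is_A_sequence_def by blast
  then show ?thesis
    unfolding A_sequence_def by (rule the1_equality[OF ex1_A_sequence[OF R]])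
qed

text \<open>
  In terms of \<open>w = h(z)\<close>, where \<open>z = g(w)\<close>, the equation \<open>z A(h(z)) = h(z)\<close> becomes
  \<open>g(w) A(w) = w\<close>; writing \<open>g = w q\<close> turns the quotient \<open>w / g\<close> into the inverse of a unit.
\<close>
lemma A_sequence_riordan_array_inverse:
  assumes d: "fps_nth d 0 \<noteq> 0" and h0: "fps_nth h 0 = 0" and h1: "fps_nth h 1 \<noteq> 0"
    and g: "g = fps_X * q" and q0: "fps_nth q 0 \<noteq> 0" and gh: "fps_compose g h = fps_X"
  shows "A_sequence (riordan_array d h) = fps_nth (inverse q)"
proof (rule A_sequence_riordan_array[OF d h0 h1])
  have "fps_X = h * fps_compose q h"
    using gh h0 by (simp add: g fps_compose_mult_distrib)
  moreover have "fps_compose q h * fps_compose (inverse q) h = 1"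
    using inverse_mult_eq_1'[OF q0] by (simp flip: fps_compose_mult_distrib[OF h0])
  ultimately show "fps_X * fps_compose (inverse q) h = h"
    by (metis mult.assoc mult.right_neutral)
qed

section \<open>Generalized Stirling numbers as a Riordan array\<close>

definition gen_stirling_h :: "'a::field_char_0 \<Rightarrow> 'a \<Rightarrow> 'a fps" where
  "gen_stirling_h \<alpha> \<beta> = fps_const (1 / \<beta>) * (binomial_series \<alpha> \<beta> - 1)"

lemma gen_stirling_h_nth_0 [simp]: "fps_nth (gen_stirling_h \<alpha> \<beta>) 0 = 0"
  by (simp add: gen_stirling_h_def gen_falling_0)

lemma gen_stirling_h_nth_1: "\<beta> \<noteq> 0 \<Longrightarrow> fps_nth (gen_stirling_h \<alpha> \<beta>) 1 = 1"
  by (simp add: gen_stirling_h_def)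

lemma poly_gen_falling:
  "poly (gen_falling p n q) x = gen_falling (poly p x) n (poly q x)"
  by (simp add: gen_falling_def poly_prod)

text \<open>
  At \<open>m \<beta>\<close> the outer series is \<open>(1 + \<beta> w)\<^sup>m\<close>, and \<open>1 + \<beta> h\<close> is \<open>(1 + \<alpha> z)\<^bsup>\<beta>/\<alpha>\<^esup>\<close>.
\<close>
lemma binomial_series_compose_of_nat:
  assumes "\<alpha> \<noteq> 0" "\<beta> \<noteq> 0"
  shows "fps_compose (binomial_series \<beta> (of_nat m * \<beta>)) (gen_stirling_h \<alpha> \<beta>) =
    binomial_series \<alpha> (of_nat m * \<beta>)"
proof -
  have "fps_const \<beta> * gen_stirling_h \<alpha> \<beta> = binomial_series \<alpha> \<beta> - 1"
    using assms by (simp add: gen_stirling_h_def flip: mult.assoc)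
  then have "fps_compose (binomial_series \<beta> \<beta>) (gen_stirling_h \<alpha> \<beta>) = binomial_series \<alpha> \<beta>"
    by (simp add: binomial_series_self fps_compose_add_distrib fps_compose_mult_distrib)
  then show ?thesis
    by (simp add: binomial_series_of_nat_mult assms flip: fps_compose_power)
qed

text \<open>
  Both sides of the defining identity are polynomials in \<open>x\<close>; they agree at the infinitely many
  points \<open>x = r + m \<beta>\<close>, where the coefficient of \<open>z\<^sup>n\<close> in
  \<open>(1 + \<alpha> z)\<^bsup>r/\<alpha>\<^esup> (1 + \<alpha> z)\<^bsup>m \<beta>/\<alpha>\<^esup>\<close> is computed in two ways.
\<close>
lemma is_gen_stirling_row_riordan_array:
  assumes \<alpha>: "\<alpha> \<noteq> 0" and \<beta>: "\<beta> \<noteq> 0"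
  shows "is_gen_stirling_row \<alpha> \<beta> r n
    (\<lambda>k. fact n * riordan_array (binomial_series \<alpha> r) (gen_stirling_h \<alpha> \<beta>) n k / fact k)"
    (is "is_gen_stirling_row _ _ _ _ ?c")
proof -
  define p where "p = gen_falling [:0, 1:] n [:\<alpha>:] -
    (\<Sum>k\<le>n. smult (?c k) (gen_falling ([:0, 1:] - [:r:]) k [:\<beta>:]))"
  have root: "poly p (r + of_nat m * \<beta>) = 0" for m
  proof -
    have "gen_falling (r + of_nat m * \<beta>) n \<alpha> / fact n =
        fps_nth (binomial_series \<alpha> r * fps_compose (binomial_series \<beta> (of_nat m * \<beta>))
          (gen_stirling_h \<alpha> \<beta>)) n"
      by (simp add: binomial_series_compose_of_nat[OF \<alpha> \<beta>] flip: binomial_series_add[OF \<alpha>])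
    also have "\<dots> = (\<Sum>k\<le>n. gen_falling (of_nat m * \<beta>) k \<beta> / fact k *
        riordan_array (binomial_series \<alpha> r) (gen_stirling_h \<alpha> \<beta>) n k)"
      by (simp add: riordan_array_apply)
    finally have "gen_falling (r + of_nat m * \<beta>) n \<alpha> =
        (\<Sum>k\<le>n. ?c k * gen_falling (of_nat m * \<beta>) k \<beta>)"
      by (simp add: divide_eq_eq sum_distrib_left sum_distrib_right mult_ac)
    then show ?thesis
      by (simp add: p_def poly_gen_falling poly_sum)
  qed
  have "inj (\<lambda>m. r + of_nat m * \<beta>)"
    using \<beta> by (intro injI) simp
  then have "infinite (range (\<lambda>m. r + of_nat m * \<beta>))"
    using finite_imageD infinite_UNIV_nat by blast
  moreover have "range (\<lambda>m. r + of_nat m * \<beta>) \<subseteq> {x. poly p x = 0}"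
    using root by auto
  ultimately have "p = 0"
    using poly_roots_finite finite_subset by blast
  moreover have "\<forall>k>n. ?c k = 0"
    by (simp add: riordan_array_above_diagonal)
  ultimately show ?thesis
    by (simp add: is_gen_stirling_row_def p_def)
qed

lemma gen_stirling_eq_riordan_array:
  assumes "\<alpha> \<noteq> 0" "\<beta> \<noteq> 0"
  shows "fact k * gen_stirling \<alpha> \<beta> r n k / fact n =
    riordan_array (binomial_series \<alpha> r) (gen_stirling_h \<alpha> \<beta>) n k"
proof -
  have "gen_stirling \<alpha> \<beta> r n =
      (\<lambda>k. fact n * riordan_array (binomial_series \<alpha> r) (gen_stirling_h \<alpha> \<beta>) n k / fact k)"
    unfolding gen_stirling_def
    by (rule the1_equality[OF ex1_gen_stirling_row]) (rule is_gen_stirling_row_riordan_array[OF assms])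
  then show ?thesis by simp
qed

text \<open>
  This extends \<open>binomial_series_compose_of_nat\<close> from the multiples of \<open>\<beta>\<close> to all \<open>x\<close>: evaluate
  at \<open>x\<close> the polynomial identity for \<open>r = 0\<close>.
\<close>
lemma binomial_series_compose:
  assumes "\<alpha> \<noteq> 0" "\<beta> \<noteq> 0"
  shows "fps_compose (binomial_series \<beta> x) (gen_stirling_h \<alpha> \<beta>) = binomial_series \<alpha> x"
proof (rule fps_ext)
  fix n
  let ?D = "riordan_array 1 (gen_stirling_h \<alpha> \<beta>) n"
  have "poly (gen_falling [:0, 1:] n [:\<alpha>:]) x =
      poly (\<Sum>k\<le>n. smult (fact n * ?D k / fact k) (gen_falling ([:0, 1:] - [:0:]) k [:\<beta>:])) x"
    using is_gen_stirling_row_riordan_array[OF assms, of 0 n]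
    by (simp only: is_gen_stirling_row_def binomial_series_0)
  then have "gen_falling x n \<alpha> / fact n = (\<Sum>k\<le>n. gen_falling x k \<beta> / fact k * ?D k)"
    by (simp add: poly_gen_falling poly_sum divide_eq_eq sum_distrib_left sum_distrib_right mult_ac)
  also have "\<dots> = fps_nth (1 * fps_compose (binomial_series \<beta> x) (gen_stirling_h \<alpha> \<beta>)) n"
    by (simp only: riordan_array_apply gen_stirling_h_nth_0 binomial_series_nth)
  finally show "fps_nth (fps_compose (binomial_series \<beta> x) (gen_stirling_h \<alpha> \<beta>)) n =
      fps_nth (binomial_series \<alpha> x) n"
    by simp
qed

text \<open>
  Exchanging \<open>\<alpha>\<close> and \<open>\<beta>\<close> inverts \<open>h\<close>: for \<open>x = \<alpha>\<close> the right-hand side of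
  \<open>binomial_series_compose\<close> is the linear series \<open>1 + \<alpha> z\<close>.
\<close>
lemma gen_stirling_h_compose:
  assumes "\<alpha> \<noteq> 0" "\<beta> \<noteq> 0"
  shows "fps_compose (gen_stirling_h \<beta> \<alpha>) (gen_stirling_h \<alpha> \<beta>) = fps_X"
proof -
  have "fps_compose (gen_stirling_h \<beta> \<alpha>) (gen_stirling_h \<alpha> \<beta>) =
      fps_const (1 / \<alpha>) * (binomial_series \<alpha> \<alpha> - 1)"
    unfolding gen_stirling_h_def[of \<beta> \<alpha>]
    by (simp add: fps_compose_mult_distrib fps_compose_sub_distrib binomial_series_compose assms)
  then show ?thesis
    using assms by (simp add: binomial_series_self flip: mult.assoc)
qed

section \<open>The recurrence\<close>

theorem theorem4p4:
  fixes \<alpha> \<beta> r :: "'a::real_normed_field" and a :: "nat \<Rightarrow> 'a"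
  assumes "\<alpha> * \<beta> \<noteq> 0"
  assumes "a = A_sequence (\<lambda>n k. fact k * gen_stirling \<alpha> \<beta> r n k / fact n)"
  shows "a 0 = 1 \<and>
    (\<forall>n\<ge>1. a n = - (1 / \<alpha>) * (\<Sum>k=1..n. a (n - k) * (gen_falling \<alpha> (k + 1) \<beta> / fact (k + 1))))"
proof -
  have \<alpha>: "\<alpha> \<noteq> 0" and \<beta>: "\<beta> \<noteq> 0"
    using assms(1) by auto
  define q where "q = fps_shift 1 (gen_stirling_h \<beta> \<alpha>)"
  have q_nth: "fps_nth q k = gen_falling \<alpha> (k + 1) \<beta> / fact (k + 1) / \<alpha>" for k
    by (simp add: q_def gen_stirling_h_def)
  have q0: "fps_nth q 0 = 1"
    using \<alpha> by (simp add: q_nth)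
  have a: "a = fps_nth (inverse q)"
    unfolding assms(2) gen_stirling_eq_riordan_array[OF \<alpha> \<beta>]
  proof (rule A_sequence_riordan_array_inverse)
    show "gen_stirling_h \<beta> \<alpha> = fps_X * q"
      by (rule fps_ext) (simp add: q_def)
  qed (use \<beta> q0 in \<open>simp_all add: gen_falling_0 gen_stirling_h_nth_1[simplified]
      gen_stirling_h_compose[OF \<alpha> \<beta>]\<close>)
  have "a n = - (1 / \<alpha>) * (\<Sum>k=1..n. a (n - k) * (gen_falling \<alpha> (k + 1) \<beta> / fact (k + 1)))"
    if "n \<ge> 1" for n
  proof -
    have "0 = fps_nth (q * inverse q) n"
      using that inverse_mult_eq_1'[of q] q0 by simp
    also have "\<dots> = a n + (\<Sum>k=1..n. fps_nth q k * a (n - k))"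
      by (simp add: fps_mult_nth a q0 sum.atLeast_Suc_atMost)
    also have "(\<Sum>k=1..n. fps_nth q k * a (n - k)) =
        (1 / \<alpha>) * (\<Sum>k=1..n. a (n - k) * (gen_falling \<alpha> (k + 1) \<beta> / fact (k + 1)))"
      unfolding q_nth sum_distrib_left by (intro sum.cong) (simp_all add: mult_ac)
    finally show ?thesis
      by (simp add: eq_neg_iff_add_eq_0)
  qed
  then show ?thesis
    using q0 by (simp add: a)
qed

end
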